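(* Let $T$ be a tree and let $L$ be its set of leaves. Then $\gamma_{11}(T)=2\gamma(T)-1$ if and only if the following conditions hold: 1. the set $S$ of strong support vertices of $T$ is an independent dominating set; 2. any connected component $C$ of $T-(S\cup L)$ satisfies $|N(V(C))\cap S|=|V(C)|+1$, that is, every vertex in $C$ has exactly one neighbor in $S$ except one vertex that has two neighbors in $S$.
   Context: All graphs are finite, undirected, simple and connected; a tree is a connected acyclic graph. A leaf is a vertex of degree $1$. A support vertex is a vertex having at least one leaf in its neighborhood; a strong support vertex is a support vertex adjacent to at least two leaves. For a vertex set $X$, $N(X)$ denotes the set of all neighbors of the vertices of $X$. A set $S$ of vertices is a dominating set if every vertex not in $S$ is adjacent to at least one vertex of $S$; $\gamma(T)$ is the minimum cardinality of a dominating set of $T$. A perfect dominating set is a set $S$ of vertices such that every vertex not in $S$ is adjacent to exactly one vertex of $S$; $\gamma_{11}(T)$ is the minimum cardinality of a perfect dominating set of $T$.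
   Formalization: The tree T is required to have at least 3 vertices; for the trees with one or two vertices γ₁₁ = 2γ − 1 = 1 holds, but the set S of strong support vertices is empty and not dominating, so the equivalence as stated fails there. *)

theory Defs
  imports Graph_Theory.Digraph_Component
begin

text \<open>
  A finite simple graph is a symmetric digraph in the sense of the locale \<^locale>\<open>graph\<close>:
  the edge \<open>{u, v}\<close> is the pair of arcs \<open>u \<rightarrow> v\<close> and \<open>v \<rightarrow> u\<close>. Hence the out-degree is the
  degree, and the strongly connected components are the connected components.

  The closed walk \<open>u, v, u\<close> along a single edge satisfies \<^const>\<open>pre_digraph.cycle\<close>, so the library's
  \<^const>\<open>tree\<close> excludes every symmetric digraph with an edge; the cycles of the undirected
  graph are those of length at least 3.
\<close>

definition undirected_tree :: "('a, 'b) pre_digraph \<Rightarrow> bool" where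
  "undirected_tree G \<longleftrightarrow>
     graph G \<and> connected G \<and> \<not> (\<exists>p. pre_digraph.cycle G p \<and> 3 \<le> length p)"

definition neighbors :: "('a, 'b) pre_digraph \<Rightarrow> 'a set \<Rightarrow> 'a set" where
  "neighbors G X = {v \<in> verts G. \<exists>u\<in>X. u \<rightarrow>\<^bsub>G\<^esub> v}"

definition leaves :: "('a, 'b) pre_digraph \<Rightarrow> 'a set" where
  "leaves G = {v \<in> verts G. out_degree G v = 1}"

definition support_vertices :: "('a, 'b) pre_digraph \<Rightarrow> 'a set" where
  "support_vertices G = {v \<in> verts G. neighbors G {v} \<inter> leaves G \<noteq> {}}"

definition strong_support_vertices :: "('a, 'b) pre_digraph \<Rightarrow> 'a set" where
  "strong_support_vertices G =
     {v \<in> support_vertices G. 2 \<le> card (neighbors G {v} \<inter> leaves G)}"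

definition independent_set :: "('a, 'b) pre_digraph \<Rightarrow> 'a set \<Rightarrow> bool" where
  "independent_set G S \<longleftrightarrow> S \<subseteq> verts G \<and> (\<forall>u\<in>S. \<forall>v\<in>S. \<not> u \<rightarrow>\<^bsub>G\<^esub> v)"

definition dominating_set :: "('a, 'b) pre_digraph \<Rightarrow> 'a set \<Rightarrow> bool" where
  "dominating_set G S \<longleftrightarrow> S \<subseteq> verts G \<and> (\<forall>v \<in> verts G - S. \<exists>u\<in>S. v \<rightarrow>\<^bsub>G\<^esub> u)"

definition perfect_dominating_set :: "('a, 'b) pre_digraph \<Rightarrow> 'a set \<Rightarrow> bool" where
  "perfect_dominating_set G S \<longleftrightarrow>
     S \<subseteq> verts G \<and> (\<forall>v \<in> verts G - S. \<exists>!u. u \<in> S \<and> v \<rightarrow>\<^bsub>G\<^esub> u)"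

definition domination_number :: "('a, 'b) pre_digraph \<Rightarrow> nat" where
  "domination_number G = (LEAST n. \<exists>S. dominating_set G S \<and> card S = n)"

definition perfect_domination_number :: "('a, 'b) pre_digraph \<Rightarrow> nat" where
  "perfect_domination_number G = (LEAST n. \<exists>S. perfect_dominating_set G S \<and> card S = n)"

definition components_outside :: "('a, 'b) pre_digraph \<Rightarrow> 'a set \<Rightarrow> ('a, 'b) pre_digraph set" where
  "components_outside G X = pre_digraph.sccs (G \<restriction> (verts G - X))"

end

theory Submission
  imports Defs
begin

text \<open>
  Give a vertex set \<open>X\<close> the weight \<open>2|X| - e(X)\<close>, where \<open>e(X)\<close> is the number of edges inside \<open>X\<close>. In
  a tree \<open>e(X) \<le> |X| - 1\<close> for nonempty \<open>X\<close>, with equality for connected \<open>X\<close>. Adding to a dominating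
  set \<open>D\<close>, one after another, vertices with two neighbours in the current set does not increase the
  weight and ends in a perfect dominating set, so \<open>\<gamma>\<^sub>1\<^sub>1(T) + 1\<close> is at most the weight of \<open>D\<close>. In
  particular \<open>\<gamma>\<^sub>1\<^sub>1(T) \<le> 2\<gamma>(T) - 1\<close>, and in the case of equality every dominating set has weight at
  least \<open>2\<gamma>(T)\<close>. This forces a leafless minimum dominating set to be independent, to grow to the
  set of all non-leaves, and to consist of strong support vertices only; the component condition
  says that adding a component of \<open>T - (S \<union> L)\<close> to \<open>S\<close> leaves the weight unchanged. Conversely,
  the component condition makes every perfect dominating set contain all non-leaves, whose number
  is then \<open>2\<gamma>(T) - 1\<close>.
\<close>

section \<open>Counting edges in a graph\<close>

context graph
begin

abbreviation adj :: "'a \<Rightarrow> 'a \<Rightarrow> bool" (infix "\<sim>" 50) where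
  "u \<sim> v \<equiv> u \<rightarrow>\<^bsub>G\<^esub> v"

abbreviation nbrs :: "'a \<Rightarrow> 'a set" where
  "nbrs v \<equiv> neighbors G {v}"

lemma in_nbrs [simp]: "u \<in> nbrs v \<longleftrightarrow> v \<sim> u"
  by (auto simp: neighbors_def dest: adj_in_verts)

lemma adj_sym: "u \<sim> v \<Longrightarrow> v \<sim> u"
  using sym_arcs by (auto simp: symmetric_def dest: symD)

lemma not_adj_self [simp]: "\<not> v \<sim> v"
  using adj_not_same by auto

lemma finite_nbrs [simp]: "finite (nbrs v)"
  by (simp add: neighbors_def)

lemma finite_subset_verts: "X \<subseteq> verts G \<Longrightarrow> finite X"
  using finite_subset[OF _ finite_verts] .

lemma out_degree_eq_card_nbrs: "out_degree G v = card (nbrs v)"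
proof -
  have "inj_on (head G) (out_arcs G v)"
    by (rule inj_onI) (simp add: no_multi_arcs arc_to_ends_def)
  moreover have "head G ` out_arcs G v = nbrs v"
    by (auto simp: neighbors_def arcs_ends_conv)
  ultimately show ?thesis
    unfolding out_degree_def by (metis card_image)
qed

lemma in_leaves: "v \<in> leaves G \<longleftrightarrow> v \<in> verts G \<and> card (nbrs v) = 1"
  by (simp add: leaves_def out_degree_eq_card_nbrs)

lemma in_strong_support_vertices:
  "v \<in> strong_support_vertices G \<longleftrightarrow> v \<in> verts G \<and> 2 \<le> card (nbrs v \<inter> leaves G)"
  by (auto simp: strong_support_vertices_def support_vertices_def)

text \<open>Doubletons rather than arcs, so that the two arcs of an edge count once.\<close>

definition edges_within :: "'a set \<Rightarrow> 'a set set" where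
  "edges_within X = {{a, b} | a b. a \<in> X \<and> b \<in> X \<and> a \<sim> b}"

text \<open>Oriented from \<open>X\<close> to \<open>Y\<close>: for disjoint sets each edge between
  them yields exactly one pair.\<close>

definition crossing :: "'a set \<Rightarrow> 'a set \<Rightarrow> ('a \<times> 'a) set" where
  "crossing X Y = {(a, b). a \<in> X \<and> b \<in> Y \<and> a \<sim> b}"

definition weight :: "'a set \<Rightarrow> int" where
  "weight X = 2 * int (card X) - int (card (edges_within X))"

lemma finite_edges_within: "finite X \<Longrightarrow> finite (edges_within X)"
  by (rule finite_subset[of _ "Pow X"]) (auto simp: edges_within_def)

lemma finite_crossing: "finite X \<Longrightarrow> finite Y \<Longrightarrow> finite (crossing X Y)"
  by (rule finite_subset[of _ "X \<times> Y"]) (auto simp: crossing_def)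

lemma card_edges_within_Un:
  assumes "finite X" "finite Y" "X \<inter> Y = {}"
  shows "card (edges_within (X \<union> Y)) =
    card (edges_within X) + card (edges_within Y) + card (crossing X Y)"
proof -
  let ?F = "(\<lambda>(a, b). {a, b}) ` crossing X Y"
  have eq: "edges_within (X \<union> Y) = (edges_within X \<union> edges_within Y) \<union> ?F"
  proof
    show "edges_within (X \<union> Y) \<subseteq> (edges_within X \<union> edges_within Y) \<union> ?F"
    proof
      fix e assume "e \<in> edges_within (X \<union> Y)"
      then obtain a b where ab: "e = {a, b}" "a \<in> X \<union> Y" "b \<in> X \<union> Y" "a \<sim> b"
        by (auto simp: edges_within_def)
      have "e = {b, a}" "b \<sim> a"
        using ab adj_sym by auto
      have cross: "e \<in> ?F" if "c \<in> X" "d \<in> Y" "c \<sim> d" "e = {c, d}" for c d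
        using that by (intro image_eqI[of _ _ "(c, d)"]) (auto simp: crossing_def)
      have within: "e \<in> edges_within Z" if "a \<in> Z" "b \<in> Z" for Z
        using that ab unfolding edges_within_def by blast
      show "e \<in> (edges_within X \<union> edges_within Y) \<union> ?F"
        using ab(2,3) within cross[OF _ _ ab(4,1)] cross[OF _ _ \<open>b \<sim> a\<close> \<open>e = {b, a}\<close>] by blast
    qed
    show "(edges_within X \<union> edges_within Y) \<union> ?F \<subseteq> edges_within (X \<union> Y)"
      by (auto simp: edges_within_def crossing_def)
  qed
  have "inj_on (\<lambda>(a, b). {a, b}) (crossing X Y)"
    using assms(3) by (auto simp: inj_on_def crossing_def doubleton_eq_iff)
  then have "card ?F = card (crossing X Y)"
    by (rule card_image)
  moreover have "(edges_within X \<union> edges_within Y) \<inter> ?F = {}"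
    using assms(3) by (auto simp: edges_within_def crossing_def doubleton_eq_iff)
  moreover have "edges_within X \<inter> edges_within Y = {}"
    using assms(3) by (auto simp: edges_within_def doubleton_eq_iff)
  ultimately show ?thesis
    using assms by (simp add: eq card_Un_disjoint finite_edges_within finite_crossing)
qed

lemma edges_within_singleton [simp]: "edges_within {v} = {}"
  by (auto simp: edges_within_def)

lemma card_edges_within_insert:
  assumes "finite X" "v \<notin> X"
  shows "card (edges_within (insert v X)) = card (edges_within X) + card (nbrs v \<inter> X)"
proof -
  have "crossing X {v} = (\<lambda>u. (u, v)) ` (nbrs v \<inter> X)"
    using adj_sym by (auto simp: crossing_def)
  moreover have "inj_on (\<lambda>u. (u, v)) (nbrs v \<inter> X)"
    by (auto intro: inj_onI)
  ultimately have "card (crossing X {v}) = card (nbrs v \<inter> X)"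
    by (metis card_image)
  then show ?thesis
    using card_edges_within_Un[of X "{v}"] assms by simp
qed

lemma weight_insert:
  assumes "finite X" "v \<notin> X"
  shows "weight (insert v X) = weight X + 2 - int (card (nbrs v \<inter> X))"
  using assms by (simp add: weight_def card_edges_within_insert)

lemma weight_Un:
  assumes "finite X" "finite Y" "X \<inter> Y = {}"
  shows "weight (X \<union> Y) = weight X + weight Y - int (card (crossing X Y))"
  using assms by (simp add: weight_def card_edges_within_Un card_Un_disjoint)

lemma weight_remove:
  assumes "finite X" "v \<in> X"
  shows "weight X = weight (X - {v}) + 2 - int (card (nbrs v \<inter> (X - {v})))"
  using weight_insert[of "X - {v}" v] assms by (simp add: insert_absorb)

lemma card_crossing_right:
  assumes "finite X" "finite Y"
  shows "card (crossing X Y) = (\<Sum>y\<in>Y. card (nbrs y \<inter> X))"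
proof -
  have "crossing X Y = prod.swap ` (SIGMA y:Y. nbrs y \<inter> X)"
    using adj_sym by (force simp: crossing_def)
  moreover have "inj_on prod.swap (SIGMA y:Y. nbrs y \<inter> X)"
    by auto
  ultimately have "card (crossing X Y) = card (SIGMA y:Y. nbrs y \<inter> X)"
    by (metis card_image)
  then show ?thesis
    using assms by (simp add: card_SigmaI)
qed

text \<open>Connectedness of \<open>X\<close> without paths: every proper part that contains
  \<open>r\<close> has an edge to the rest of \<open>X\<close>. In this form \<open>X\<close> can be
  built up from \<open>r\<close> by adding adjacent vertices.\<close>

definition linked_from :: "'a \<Rightarrow> 'a set \<Rightarrow> bool" where
  "linked_from r X \<longleftrightarrow>
     r \<in> X \<and> (\<forall>Y. r \<in> Y \<longrightarrow> Y \<subset> X \<longrightarrow> (\<exists>a\<in>Y. \<exists>b\<in>X - Y. a \<sim> b))"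

lemma linked_fromD:
  assumes "linked_from r X" "r \<in> Y" "Y \<subset> X"
  obtains a b where "a \<in> Y" "b \<in> X - Y" "a \<sim> b"
  using assms unfolding linked_from_def by blast

text \<open>A part that contains \<open>r\<close> and has no edge to the rest would be closed under
  \<open>R\<close>. The later use takes \<open>R\<close> to be adjacency avoiding one
  vertex.\<close>

lemma linked_from_rtranclp:
  assumes "\<And>a b. R a b \<Longrightarrow> a \<sim> b"
  shows "linked_from r {v. R\<^sup>*\<^sup>* r v}"
  unfolding linked_from_def
proof (intro conjI allI impI)
  fix Y assume Y: "r \<in> Y" "Y \<subset> {v. R\<^sup>*\<^sup>* r v}"
  show "\<exists>a\<in>Y. \<exists>b\<in>{v. R\<^sup>*\<^sup>* r v} - Y. a \<sim> b"
  proof (rule ccontr)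
    assume no: "\<not> ?thesis"
    have "R\<^sup>*\<^sup>* r v \<Longrightarrow> v \<in> Y" for v
    proof (induction rule: rtranclp_induct)
      case (step y z)
      then show ?case
        using no assms by (metis DiffI mem_Collect_eq rtranclp.rtrancl_into_rtrancl)
    qed (use Y in auto)
    with Y show False by blast
  qed
qed auto

lemma linked_from_strongly_connected:
  assumes "strongly_connected H" "subgraph H G" "r \<in> verts H"
  shows "linked_from r (verts H)"
  unfolding linked_from_def
proof (intro conjI allI impI)
  fix Y assume Y: "r \<in> Y" "Y \<subset> verts H"
  interpret H: wf_digraph H
    using assms(2) by (auto simp: subgraph_def)
  have sub: "a \<rightarrow>\<^bsub>H\<^esub> b \<Longrightarrow> a \<sim> b" for a b
    using assms(2) arcs_ends_mono by blast
  show "\<exists>a\<in>Y. \<exists>b\<in>verts H - Y. a \<sim> b"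
  proof (rule ccontr)
    assume no: "\<not> ?thesis"
    have "r \<rightarrow>\<^sup>*\<^bsub>H\<^esub> v \<Longrightarrow> v \<in> Y" for v
    proof (induction rule: H.reachable_induct)
      case (step x y)
      then show ?case
        using no sub by (metis DiffI H.adj_in_verts(2))
    qed (use Y in auto)
    then show False
      using Y assms(1,3) unfolding strongly_connected_def by blast
  qed
qed (use assms in auto)

text \<open>A maximal \<open>Y\<close> that contains \<open>r\<close> and satisfies the bound must
  be all of \<open>X\<close>: otherwise an edge leaves \<open>Y\<close> within \<open>X\<close>, and
  adding its far end brings at least one new edge.\<close>

lemma linked_from_card_le:
  assumes "linked_from r X" "finite X"
  shows "card X \<le> card (edges_within X) + 1"
proof -
  define P where "P Y \<longleftrightarrow> r \<in> Y \<and> Y \<subseteq> X \<and> card Y \<le> card (edges_within Y) + 1" for Y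
  have "finite {Y. P Y}"
    by (rule finite_subset[of _ "Pow X"]) (auto simp: P_def assms(2))
  moreover have "P {r}"
    using assms(1) by (auto simp: P_def linked_from_def)
  ultimately obtain Y where "P Y" and max: "\<And>Z. P Z \<Longrightarrow> Y \<subseteq> Z \<Longrightarrow> Y = Z"
    by (metis (mono_tags, lifting) finite_has_maximal2 mem_Collect_eq)
  have fin: "finite Y"
    using \<open>P Y\<close> assms(2) finite_subset by (auto simp: P_def)
  have "Y = X"
  proof (rule ccontr)
    assume "Y \<noteq> X"
    then obtain a b where ab: "a \<in> Y" "b \<in> X - Y" "a \<sim> b"
      using linked_fromD[OF assms(1)] \<open>P Y\<close> by (auto simp: P_def)
    have "a \<in> nbrs b \<inter> Y"
      using ab adj_sym by auto
    then have "1 \<le> card (nbrs b \<inter> Y)"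
      by (metis One_nat_def Suc_leI card_gt_0_iff empty_iff finite_Int finite_nbrs)
    then have "P (insert b Y)"
      using ab fin \<open>P Y\<close> by (auto simp: P_def card_edges_within_insert)
    then show False
      using max ab by blast
  qed
  with \<open>P Y\<close> show ?thesis by (simp add: P_def)
qed

text \<open>The saturation of \<open>D\<close>: vertices with two neighbours in the current set are added, except
  those of \<open>Z\<close>. Such a step costs \<open>2\<close> and gains at least two edges.\<close>

lemma saturation_exists:
  assumes "D \<subseteq> verts G"
  obtains Q where "D \<subseteq> Q" "Q \<subseteq> verts G" "(Q - D) \<inter> Z = {}"
    "\<And>v. v \<in> verts G - Q - Z \<Longrightarrow> card (nbrs v \<inter> Q) \<le> 1"
    "weight Q \<le> weight D"
    "\<And>R. D \<subseteq> R \<Longrightarrow> (\<And>v. v \<in> verts G - R - Z \<Longrightarrow> card (nbrs v \<inter> R) \<le> 1) \<Longrightarrow> Q \<subseteq> R"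
  using assms
proof (induction "card (verts G - D)" arbitrary: D thesis rule: less_induct)
  case less
  show ?case
  proof (cases "\<forall>v \<in> verts G - D - Z. card (nbrs v \<inter> D) \<le> 1")
    case True
    show ?thesis
      by (rule less.prems(1)[of D]) (use True less.prems(2) in auto)
  next
    case False
    then obtain v where v: "v \<in> verts G - D - Z" "\<not> card (nbrs v \<inter> D) \<le> 1"
      by blast
    have "card (verts G - insert v D) < card (verts G - D)"
      by (rule psubset_card_mono) (use v in auto)
    moreover have "insert v D \<subseteq> verts G"
      using v less.prems(2) by auto
    ultimately obtain Q where Q: "insert v D \<subseteq> Q" "Q \<subseteq> verts G" "(Q - insert v D) \<inter> Z = {}"
      "\<And>v. v \<in> verts G - Q - Z \<Longrightarrow> card (nbrs v \<inter> Q) \<le> 1"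
      "weight Q \<le> weight (insert v D)"
      "\<And>R. insert v D \<subseteq> R \<Longrightarrow>
        (\<And>v. v \<in> verts G - R - Z \<Longrightarrow> card (nbrs v \<inter> R) \<le> 1) \<Longrightarrow> Q \<subseteq> R"
      using less.hyps by blast
    show ?thesis
    proof (rule less.prems(1)[of Q])
      have "weight (insert v D) \<le> weight D"
        using v less.prems(2) finite_subset_verts by (simp add: weight_insert)
      then show "weight Q \<le> weight D"
        using Q(5) by simp
      fix R
      assume R: "D \<subseteq> R" "\<And>v. v \<in> verts G - R - Z \<Longrightarrow> card (nbrs v \<inter> R) \<le> 1"
      \<comment> \<open>\<open>v\<close> has two neighbours in \<open>D\<close>, hence in
        \<open>R\<close>; a set \<open>R\<close> closed under the rule must therefore contain
        \<open>v\<close>.\<close>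
      have "card (nbrs v \<inter> D) \<le> card (nbrs v \<inter> R)"
        using R(1) by (intro card_mono) auto
      then have "v \<in> R"
        using R(2)[of v] v by force
      with R Q(6) show "Q \<subseteq> R" by simp
    qed (use Q v in auto)
  qed
qed

section \<open>Dominating and perfect dominating sets\<close>

lemma dominating_setD:
  assumes "dominating_set G D" "v \<in> verts G" "v \<notin> D"
  obtains u where "u \<in> D" "v \<sim> u"
  using assms unfolding dominating_set_def by blast

lemma dominating_set_mono:
  assumes "dominating_set G D" "D \<subseteq> D'" "D' \<subseteq> verts G"
  shows "dominating_set G D'"
  using assms unfolding dominating_set_def by blast

lemma perfect_dominating_setI:
  assumes "dominating_set G D" "\<And>v. v \<in> verts G - D \<Longrightarrow> card (nbrs v \<inter> D) \<le> 1"
  shows "perfect_dominating_set G D"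
  unfolding perfect_dominating_set_def
proof (intro conjI ballI)
  fix v assume v: "v \<in> verts G - D"
  then obtain u where u: "u \<in> D" "v \<sim> u"
    using assms(1) dominating_setD by blast
  show "\<exists>!u. u \<in> D \<and> v \<sim> u"
  proof (rule ex1I[of _ u])
    fix w assume "w \<in> D \<and> v \<sim> w"
    then have "{u, w} \<subseteq> nbrs v \<inter> D"
      using u by auto
    then have "card {u, w} \<le> 1"
      using assms(2)[OF v] by (meson card_mono finite_Int finite_nbrs le_trans)
    then show "w = u"
      by (cases "u = w") auto
  qed (use u in auto)
qed (use assms(1) in \<open>auto simp: dominating_set_def\<close>)

lemma perfect_dominating_set_forced:
  assumes "perfect_dominating_set G P" "v \<in> verts G" "a \<in> P" "b \<in> P" "a \<noteq> b" "v \<sim> a" "v \<sim> b"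
  shows "v \<in> P"
  using assms unfolding perfect_dominating_set_def by blast

lemma dominating_set_verts: "dominating_set G (verts G)"
  by (simp add: dominating_set_def)

lemma perfect_dominating_set_verts: "perfect_dominating_set G (verts G)"
  by (simp add: perfect_dominating_set_def)

lemma domination_number_le: "dominating_set G D \<Longrightarrow> domination_number G \<le> card D"
  unfolding domination_number_def by (rule Least_le) auto

lemma domination_number_attained:
  obtains D where "dominating_set G D" "card D = domination_number G"
  using LeastI_ex[of "\<lambda>n. \<exists>S. dominating_set G S \<and> card S = n"] dominating_set_verts
  unfolding domination_number_def by blast

lemma perfect_domination_number_le:
  "perfect_dominating_set G D \<Longrightarrow> perfect_domination_number G \<le> card D"
  unfolding perfect_domination_number_def by (rule Least_le) auto

lemma perfect_domination_number_attained:
  obtains D where "perfect_dominating_set G D" "card D = perfect_domination_number G"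
  using LeastI_ex[of "\<lambda>n. \<exists>S. perfect_dominating_set G S \<and> card S = n"]
    perfect_dominating_set_verts
  unfolding perfect_domination_number_def by blast

end
section \<open>Trees\<close>

locale tree_graph = graph G for G (structure) +
  assumes connected_graph: "connected G"
    and short_cycle: "cycle p \<Longrightarrow> length p < 3"

context graph
begin

text \<open>The acyclicity assumption speaks of lists of arcs, the path argument of lists of
  vertices; the arcs are chosen here.\<close>

lemma awalk_of_vertex_list:
  assumes "xs \<noteq> []" "set xs \<subseteq> verts G" "successively (\<sim>) xs"
  shows "\<exists>p. awalk (hd xs) p (last xs) \<and> awalk_verts (hd xs) p = xs"
  using assms
proof (induction xs rule: list_nonempty_induct)
  case (single x)
  then have "awalk x [] x"
    by (simp add: awalk_def)
  then show ?case
    by (intro exI[of _ "[]"]) auto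
next
  case (cons x xs)
  then obtain p where p: "awalk (hd xs) p (last xs)" "awalk_verts (hd xs) p = xs"
    by (auto simp: successively_Cons)
  have "x \<sim> hd xs"
    using cons by (auto simp: successively_Cons)
  then obtain e where e: "e \<in> arcs G" "tail G e = x" "head G e = hd xs"
    by (auto simp: arcs_ends_conv)
  with p cons.hyps cons.prems have "awalk x (e # p) (last xs)"
    by (auto simp: awalk_Cons_iff)
  with e p cons.hyps show ?case
    by (intro exI[of _ "e # p"]) auto
qed

end

context tree_graph
begin

lemma no_cycle_list:
  assumes "3 \<le> length xs" "distinct xs" "set xs \<subseteq> verts G"
    and "successively (\<sim>) xs" "last xs \<sim> hd xs"
  shows False
proof -
  have "xs \<noteq> []"
    using assms(1) by auto
  \<comment> \<open>Starting the closed walk at \<open>last xs\<close> makes \<open>xs\<close> the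
    tail of its vertex list, which is the part that \<open>cycle\<close> requires to be
    distinct.\<close>
  then have "\<exists>p. awalk (hd (last xs # xs)) p (last (last xs # xs)) \<and>
      awalk_verts (hd (last xs # xs)) p = last xs # xs"
    using assms by (intro awalk_of_vertex_list) (auto simp: successively_Cons)
  then obtain p where p: "awalk (last xs) p (last xs)" "awalk_verts (last xs) p = last xs # xs"
    using \<open>xs \<noteq> []\<close> by auto
  have "length (awalk_verts (last xs) p) = length p + 1"
    by (simp add: length_awalk_verts)
  then have "length p = length xs"
    using p by simp
  moreover have "cycle p"
    unfolding cycle_def using p assms(1,2) \<open>length p = length xs\<close>
    by (intro exI[of _ "last xs"]) auto
  ultimately show False
    using short_cycle assms(1) by force
qed

text \<open>Otherwise the first vertex \<open>x\<close> of a longest path in \<open>X\<close> has a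
  neighbour in \<open>X\<close> besides the next vertex. By maximality that neighbour lies on the
  path and closes a cycle.\<close>

lemma exists_low_degree:
  assumes "X \<subseteq> verts G" "X \<noteq> {}"
  obtains v where "v \<in> X" "card (nbrs v \<inter> X) \<le> 1"
proof (rule ccontr)
  assume no: "\<not> thesis"
  note found = that
  have deg: "2 \<le> card (nbrs v \<inter> X)" if "v \<in> X" for v
    using found[OF that] no by linarith
  let ?P = "{xs. set xs \<subseteq> X \<and> distinct xs \<and> xs \<noteq> [] \<and> successively (\<sim>) xs}"
  have "finite {xs. set xs \<subseteq> X \<and> distinct xs}"
    using assms finite_subset_verts finite_subset_distinct by blast
  then have fin: "finite (length ` ?P)"
    by (rule finite_imageI[OF finite_subset[rotated]]) auto
  obtain w where "w \<in> X"
    using assms by auto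
  then have "[w] \<in> ?P"
    by auto
  then have "length ` ?P \<noteq> {}"
    by blast
  with fin have "Max (length ` ?P) \<in> length ` ?P"
    by (rule Max_in)
  then obtain xs where xs: "xs \<in> ?P" and "length xs = Max (length ` ?P)"
    by auto
  then have max: "length ys \<le> length xs" if "ys \<in> ?P" for ys
    using fin that by simp
  obtain x zs where x: "xs = x # zs"
    using xs by (auto simp: neq_Nil_conv)
  \<comment> \<open>For empty \<open>zs\<close> the value \<open>hd zs\<close> is arbitrary; all
    that matters is that one vertex is excluded from at least two neighbours.\<close>
  have "\<not> nbrs x \<inter> X \<subseteq> {hd zs}"
    using deg[of x] card_mono[of "{hd zs}" "nbrs x \<inter> X"] xs x by auto
  then obtain u where "u \<in> nbrs x \<inter> X" "u \<notin> {hd zs}"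
    by blast
  then have u: "u \<in> X" "x \<sim> u" "u \<noteq> hd zs"
    by auto
  have "u \<in> set xs"
  proof (rule ccontr)
    assume "u \<notin> set xs"
    then have "u # xs \<in> ?P"
      using xs u x adj_sym by (auto simp: successively_Cons)
    then show False
      using max by fastforce
  qed
  moreover have "u \<noteq> x"
    using u by auto
  ultimately have "u \<in> set zs"
    using x by auto
  then obtain as bs where as: "zs = as @ u # bs"
    by (auto simp: in_set_conv_decomp)
  \<comment> \<open>\<open>u\<close> is not the head of \<open>zs\<close>, so some vertex lies
    between \<open>x\<close> and \<open>u\<close>, and the cycle has length at least three.\<close>
  then have "as \<noteq> []"
    using u by auto
  show False
  proof (rule no_cycle_list[of "x # as @ [u]"])
    show "3 \<le> length (x # as @ [u])"
      using \<open>as \<noteq> []\<close> by (cases as) auto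
    show "successively (\<sim>) (x # as @ [u])"
      using xs \<open>as \<noteq> []\<close> unfolding x as
        by (auto simp: successively_Cons successively_append_iff)
    show "last (x # as @ [u]) \<sim> hd (x # as @ [u])"
      using u adj_sym by auto
  qed (use xs x as assms in auto)
qed

text \<open>Removing a vertex with at most one neighbour in \<open>X\<close> removes at most one
  edge, and a single vertex has no edges.\<close>

lemma card_edges_within_less:
  assumes "X \<subseteq> verts G" "X \<noteq> {}"
  shows "card (edges_within X) < card X"
  using assms
proof (induction "card X" arbitrary: X)
  case 0
  then show ?case
    using finite_subset_verts by auto
next
  case (Suc n)
  obtain v where v: "v \<in> X" "card (nbrs v \<inter> X) \<le> 1"
    using exists_low_degree Suc.prems by blast
  let ?Y = "X - {v}"
  have fin: "finite X"
    using Suc.prems finite_subset_verts by auto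
  have X: "X = insert v ?Y" and "v \<notin> ?Y"
    using v by auto
  show ?case
  proof (cases "?Y = {}")
    case True
    then have "X = {v}"
      using v by auto
    then show ?thesis by simp
  next
    case False
    have "card ?Y = n"
      using v fin Suc.hyps(2) by simp
    then have "card (edges_within ?Y) < card ?Y"
      using Suc.hyps(1)[of ?Y] Suc.prems False by auto
    moreover have "card (nbrs v \<inter> ?Y) \<le> 1"
      using v(2) card_mono[of "nbrs v \<inter> X" "nbrs v \<inter> ?Y"] by force
    moreover have "card (edges_within X) = card (edges_within ?Y) + card (nbrs v \<inter> ?Y)"
      using card_edges_within_insert[of ?Y v] fin X by auto
    moreover have "card X = card ?Y + 1"
      using v(1) fin card.remove by fastforce
    ultimately show ?thesis
      by linarith
  qed
qed

lemma card_less_weight: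
  assumes "X \<subseteq> verts G" "X \<noteq> {}"
  shows "int (card X) + 1 \<le> weight X"
  using card_edges_within_less[OF assms] by (simp add: weight_def)

lemma linked_from_card_eq:
  assumes "linked_from r X" "X \<subseteq> verts G"
  shows "card X = card (edges_within X) + 1"
proof -
  have "X \<noteq> {}" "finite X"
    using assms finite_subset_verts by (auto simp: linked_from_def)
  then show ?thesis
    using linked_from_card_le[OF assms(1)] card_edges_within_less[OF assms(2)] by simp
qed

text \<open>A vertex with two neighbours in \<open>X\<close> would close a cycle.\<close>

lemma linked_from_card_nbrs_le:
  assumes "linked_from r X" "X \<subseteq> verts G" "v \<in> verts G" "v \<notin> X"
  shows "card (nbrs v \<inter> X) \<le> 1"
proof -
  have "finite X"
    using assms finite_subset_verts by auto
  moreover have "card (edges_within (insert v X)) < card (insert v X)"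
    by (rule card_edges_within_less) (use assms in auto)
  ultimately show ?thesis
    using linked_from_card_eq[OF assms(1,2)] assms(4) card_edges_within_insert[of X v] by simp
qed

lemma strongly_connected_graph: "strongly_connected G"
  using symmetric_connected_imp_strongly_connected[OF sym_arcs connected_graph] .

lemma linked_from_verts: "r \<in> verts G \<Longrightarrow> linked_from r (verts G)"
  by (rule linked_from_strongly_connected)
    (auto simp: strongly_connected_graph wf_digraph_axioms intro: subgraph_refl)

lemma weight_verts: "weight (verts G) = int (card (verts G)) + 1"
proof -
  obtain r where "r \<in> verts G"
    using strongly_connected_graph by (auto simp: strongly_connected_def)
  then show ?thesis
    using linked_from_card_eq[OF linked_from_verts] by (simp add: weight_def)
qed

lemma dominating_set_nonempty: "dominating_set G D \<Longrightarrow> D \<noteq> {}"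
  using strongly_connected_graph unfolding dominating_set_def strongly_connected_def by auto

lemma perfect_domination_number_less_weight:
  assumes "dominating_set G D"
  shows "int (perfect_domination_number G) + 1 \<le> weight D"
proof -
  have "D \<subseteq> verts G"
    using assms by (simp add: dominating_set_def)
  then obtain Q where Q: "D \<subseteq> Q" "Q \<subseteq> verts G"
    "\<And>v. v \<in> verts G - Q - {} \<Longrightarrow> card (nbrs v \<inter> Q) \<le> 1" "weight Q \<le> weight D"
    by (rule saturation_exists[where Z = "{}"]) blast
  have dom: "dominating_set G Q"
    using assms Q dominating_set_mono by blast
  \<comment> \<open>With \<open>Z\<close> empty no vertex outside \<open>Q\<close> has two
    neighbours in \<open>Q\<close>, and \<open>Q\<close> inherits domination from
    \<open>D\<close>.\<close>
  have "perfect_dominating_set G Q"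
    by (rule perfect_dominating_setI) (use dom Q in auto)
  then have "perfect_domination_number G \<le> card Q"
    by (rule perfect_domination_number_le)
  moreover have "int (card Q) + 1 \<le> weight Q"
    by (rule card_less_weight) (use Q dom dominating_set_nonempty in auto)
  ultimately show ?thesis
    using Q(4) by linarith
qed

lemma perfect_domination_number_le_double:
  "int (perfect_domination_number G) \<le> 2 * int (domination_number G) - 1"
proof -
  obtain D where "dominating_set G D" "card D = domination_number G"
    by (rule domination_number_attained)
  then show ?thesis
    using perfect_domination_number_less_weight[of D] by (simp add: weight_def)
qed

text \<open>Guarantees that the natural subtraction in \<open>2 * domination_number G - 1\<close> is
  not truncated.\<close>

lemma domination_number_pos: "0 < domination_number G"
proof -
  obtain D where "dominating_set G D" "card D = domination_number G"
    by (rule domination_number_attained)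
  moreover from this have "D \<noteq> {}" "finite D"
    using dominating_set_nonempty finite_subset_verts by (auto simp: dominating_set_def)
  ultimately show ?thesis
    by (metis card_gt_0_iff)
qed

end

section \<open>Leaves and strong support vertices of a tree with at least three vertices\<close>

locale large_tree = tree_graph +
  assumes large: "3 \<le> card (verts G)"
begin

abbreviation L :: "'a set" where
  "L \<equiv> leaves G"

abbreviation S :: "'a set" where
  "S \<equiv> strong_support_vertices G"

lemma leaves_subset: "L \<subseteq> verts G"
  by (auto simp: in_leaves)

lemma strong_subset: "S \<subseteq> verts G"
  by (auto simp: in_strong_support_vertices)

lemma leaf_nbr_unique:
  assumes "l \<in> L" "l \<sim> a" "l \<sim> b"
  shows "a = b"
proof -
  obtain c where "nbrs l = {c}"
    using assms(1) by (auto simp: in_leaves card_1_singleton_iff)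
  then show ?thesis
    using assms by (metis in_nbrs singleton_iff)
qed

lemma leaf_nbr_exists:
  assumes "l \<in> L"
  obtains u where "l \<sim> u"
proof -
  have "nbrs l \<noteq> {}"
    using assms by (auto simp: in_leaves)
  then show ?thesis
    using that in_nbrs by blast
qed

text \<open>Two adjacent leaves have no other neighbours, so no edge would leave the pair; with a
  third vertex this contradicts connectedness.\<close>

lemma leaf_nbr_not_leaf:
  assumes "l \<in> L" "l \<sim> u"
  shows "u \<notin> L"
proof
  assume "u \<in> L"
  have "u \<sim> l"
    using assms adj_sym by auto
  have "{l, u} \<subset> verts G"
  proof -
    have "{l, u} \<subseteq> verts G"
      using assms \<open>u \<in> L\<close> leaves_subset by auto
    moreover have "card {l, u} \<le> 2"
      by (cases "l = u") auto
    ultimately show ?thesis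
      using large by auto
  qed
  moreover have "linked_from l (verts G)"
    using linked_from_verts assms leaves_subset by auto
  ultimately obtain a b where "a \<in> {l, u}" "b \<in> verts G - {l, u}" "a \<sim> b"
    using linked_fromD by (metis insertI1)
  then show False
    using leaf_nbr_unique assms \<open>u \<in> L\<close> \<open>u \<sim> l\<close> by blast
qed

lemma strong_not_leaf: "S \<inter> L = {}"
proof (rule ccontr)
  assume "S \<inter> L \<noteq> {}"
  then obtain v where v: "v \<in> S" "v \<in> L"
    by auto
  have "card (nbrs v \<inter> L) \<le> card (nbrs v)"
    by (intro card_mono) auto
  with v show False
    by (simp add: in_strong_support_vertices in_leaves)
qed

lemma strong_leaves:
  assumes "s \<in> S"
  obtains l m where "l \<in> L" "m \<in> L" "l \<noteq> m" "l \<sim> s" "m \<sim> s"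
proof -
  have "\<not> is_singleton (nbrs s \<inter> L)" "nbrs s \<inter> L \<noteq> {}"
    using assms by (auto simp: in_strong_support_vertices is_singleton_altdef)
  then obtain l m where "l \<in> nbrs s \<inter> L" "m \<in> nbrs s \<inter> L" "l \<noteq> m"
    by (metis is_singletonI')
  then show ?thesis
    using that adj_sym by auto
qed

text \<open>A leaf outside \<open>D\<close> can be dominated only by its single neighbour.\<close>

lemma strong_subset_dominating:
  assumes "dominating_set G D" "D \<inter> L = {}"
  shows "S \<subseteq> D"
proof
  fix s assume "s \<in> S"
  then obtain l where l: "l \<in> L" "l \<sim> s"
    using strong_leaves by metis
  then obtain u where "u \<in> D" "l \<sim> u"
    using assms dominating_setD leaves_subset by (metis IntI empty_iff subsetD)
  then show "s \<in> D"
    using l leaf_nbr_unique by blast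
qed

text \<open>If one of two leaves at \<open>s\<close> is outside \<open>P\<close>, only
  \<open>s\<close> can dominate it; if both are in \<open>P\<close>, then \<open>s\<close> has two
  neighbours in \<open>P\<close>.\<close>

lemma strong_subset_perfect_dominating:
  assumes "perfect_dominating_set G P"
  shows "S \<subseteq> P"
proof
  fix s assume s: "s \<in> S"
  then obtain l m where lm: "l \<in> L" "m \<in> L" "l \<noteq> m" "l \<sim> s" "m \<sim> s"
    using strong_leaves by metis
  have "s \<in> P" if "x \<in> L" "x \<sim> s" "x \<notin> P" for x
    using that assms leaf_nbr_unique leaves_subset
    unfolding perfect_dominating_set_def by (metis DiffI subsetD)
  moreover have "s \<in> P" if "l \<in> P" "m \<in> P"
    using perfect_dominating_set_forced[OF assms _ that] lm s strong_subset adj_sym by blast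
  ultimately show "s \<in> P"
    using lm by blast
qed

text \<open>Each leaf in a minimum dominating set can be replaced by its neighbour, which is not a
  leaf. Domination survives, and minimality keeps the cardinality from dropping.\<close>

lemma leafless_minimum_dominating_set:
  obtains D where "dominating_set G D" "card D = domination_number G" "D \<inter> L = {}"
proof -
  obtain D where D: "dominating_set G D" "card D = domination_number G"
    by (rule domination_number_attained)
  \<comment> \<open>The choice is unambiguous, since a leaf has exactly one neighbour.\<close>
  define f where "f x = (if x \<in> L then SOME u. x \<sim> u else x)" for x
  have leaf: "x \<sim> f x" if x: "x \<in> L" for x
  proof -
    obtain u where "x \<sim> u"
      using leaf_nbr_exists[OF x] .
    then show ?thesis
      using x by (auto simp: f_def intro: someI)
  qed
  have nonleaf: "f x = x" if "x \<notin> L" for x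
    using that by (simp add: f_def)
  have D_sub: "D \<subseteq> verts G"
    using D by (simp add: dominating_set_def)
  have sub: "f ` D \<subseteq> verts G"
  proof (rule image_subsetI)
    fix x assume "x \<in> D"
    show "f x \<in> verts G"
    proof (cases "x \<in> L")
      case True
      show ?thesis
        by (rule adj_in_verts(2)[OF leaf[OF True]])
    next
      case False
      show ?thesis
        unfolding nonleaf[OF False] using \<open>x \<in> D\<close> D_sub by blast
    qed
  qed
  have "dominating_set G (f ` D)"
    unfolding dominating_set_def
  proof (intro conjI ballI sub)
    fix v assume v: "v \<in> verts G - f ` D"
    show "\<exists>u\<in>f ` D. v \<sim> u"
    proof (cases "v \<in> D")
      case True
      then have "v \<in> L"
        using v nonleaf by force
      then show ?thesis
        using True leaf by blast
    next
      case False
      then obtain u where u: "u \<in> D" "v \<sim> u"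
        using v D dominating_setD by blast
      \<comment> \<open>If \<open>u\<close> were a leaf, its only neighbour would be
        \<open>v\<close>, so \<open>v\<close> itself would lie in the image.\<close>
      have "u \<notin> L"
      proof
        assume "u \<in> L"
        then have "f u = v"
          using leaf leaf_nbr_unique u adj_sym by blast
        then show False
          using u v by blast
      qed
      then show ?thesis
        using u nonleaf by (metis image_eqI)
    qed
  qed
  moreover have "card (f ` D) = domination_number G"
    using D card_image_le[of D f] finite_subset_verts[OF D_sub] domination_number_le[OF calculation]
    by simp
  moreover have "f x \<notin> L" for x
    using leaf_nbr_not_leaf[OF _ leaf] nonleaf[of x] by (cases "x \<in> L") simp_all
  then have "f ` D \<inter> L = {}"
    by blast
  ultimately show ?thesis
    using that by blast
qed

text \<open>Each leaf put back adds at most one edge, so it raises the weight by at least one; the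
  weight of the whole tree is known.\<close>

lemma weight_nonleaves: "weight (verts G - L) \<le> int (card (verts G - L)) + 1"
proof -
  have fin: "finite L"
    using leaves_subset finite_subset_verts by auto
  have "weight (verts G - L) + int (card K) \<le> weight ((verts G - L) \<union> K)" if "K \<subseteq> L" for K
    using finite_subset[OF that fin] that
  proof (induction K rule: finite_induct)
    case (insert l K)
    let ?X = "verts G - L \<union> K"
    have "card (nbrs l \<inter> ?X) \<le> card (nbrs l)"
      by (intro card_mono) auto
    moreover have "card (nbrs l) = 1"
      using insert by (auto simp: in_leaves)
    moreover have "weight (insert l ?X) = weight ?X + 2 - int (card (nbrs l \<inter> ?X))"
      by (rule weight_insert) (use insert in auto)
    ultimately show ?case
      using insert by simp
  qed auto
  from this[of L] have "weight (verts G - L) + int (card L) \<le> weight (verts G)"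
    using leaves_subset by (simp add: Un_absorb2)
  moreover have "card (verts G) = card (verts G - L) + card L"
    using fin leaves_subset by (metis card_Diff_subset card_mono finite_verts le_add_diff_inverse2)
  ultimately show ?thesis
    using weight_verts by simp
qed

lemma card_strong_le_domination_number: "card S \<le> domination_number G"
proof -
  obtain D where D: "dominating_set G D" "card D = domination_number G" "D \<inter> L = {}"
    by (rule leafless_minimum_dominating_set)
  then have "finite D"
    using finite_subset_verts by (auto simp: dominating_set_def)
  then show ?thesis
    using card_mono strong_subset_dominating D by metis
qed

end

section \<open>Minimum dominating sets in the case of equality\<close>

locale extremal_tree = large_tree +
  assumes extremal: "perfect_domination_number G = 2 * domination_number G - 1"
begin

lemma dominating_weight_ge:
  assumes "dominating_set G D"
  shows "2 * int (domination_number G) \<le> weight D"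
  using perfect_domination_number_less_weight[OF assms] extremal domination_number_pos by linarith

lemma minimum_dominating_no_edges:
  assumes "dominating_set G D" "card D = domination_number G"
  shows "edges_within D = {}"
proof -
  have "card (edges_within D) = 0"
    using dominating_weight_ge[OF assms(1)] assms(2) by (simp add: weight_def)
  moreover have "finite D"
    using assms finite_subset_verts by (auto simp: dominating_set_def)
  ultimately show ?thesis
    using finite_edges_within by auto
qed

lemma minimum_dominating_independent:
  assumes "dominating_set G D" "card D = domination_number G" "a \<in> D" "b \<in> D"
  shows "\<not> a \<sim> b"
  using minimum_dominating_no_edges[OF assms(1,2)] assms(3,4) by (auto simp: edges_within_def)

lemma minimum_dominating_weight:
  assumes "dominating_set G D" "card D = domination_number G"
  shows "weight D = 2 * int (domination_number G)"
  using minimum_dominating_no_edges[OF assms] assms(2) by (simp add: weight_def)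

text \<open>For the saturation \<open>P\<close> of \<open>D\<close>, the bounds
  \<open>2 * domination_number G\<close> \<le> \<open>card P + 1\<close> \<le>
  \<open>weight P\<close> \<le> \<open>weight D\<close> collapse to equalities, which forces
  \<open>P\<close> to be the set of non-leaves. The second claim is then the leastness of
  \<open>P\<close>.\<close>

lemma minimum_dominating_saturation:
  assumes D: "dominating_set G D" "card D = domination_number G" "D \<inter> L = {}"
  shows "weight (verts G - L) = 2 * int (domination_number G)" (is ?thesis1)
    and "D \<subseteq> R \<Longrightarrow> (\<And>v. v \<in> verts G - R \<Longrightarrow> card (nbrs v \<inter> R) \<le> 1) \<Longrightarrow> verts G - L \<subseteq> R"
      (is "_ \<Longrightarrow> (\<And>v. _ v \<Longrightarrow> _ v) \<Longrightarrow> ?thesis2")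
proof -
  have D_sub: "D \<subseteq> verts G"
    using D by (simp add: dominating_set_def)
  then obtain P where P: "D \<subseteq> P" "P \<subseteq> verts G"
    "\<And>v. v \<in> verts G - P - {} \<Longrightarrow> card (nbrs v \<inter> P) \<le> 1" "weight P \<le> weight D"
    and least: "\<And>R. D \<subseteq> R \<Longrightarrow>
      (\<And>v. v \<in> verts G - R - {} \<Longrightarrow> card (nbrs v \<inter> R) \<le> 1) \<Longrightarrow> P \<subseteq> R"
    by (rule saturation_exists[where Z = "{}"]) blast
  have fin: "finite P"
    using P finite_subset_verts by auto
  have dom: "dominating_set G P"
    using D P dominating_set_mono by blast
  have perf: "perfect_dominating_set G P"
    by (rule perfect_dominating_setI) (use dom P in auto)
  have "2 * int (domination_number G) \<le> int (card P) + 1"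
    using perfect_domination_number_le[OF perf] extremal domination_number_pos by linarith
  moreover have "int (card P) + 1 \<le> weight P"
    by (rule card_less_weight) (use P dom dominating_set_nonempty in auto)
  ultimately have weight: "weight P = int (card P) + 1" "weight P = 2 * int (domination_number G)"
    using P(4) minimum_dominating_weight[OF D(1,2)] by auto
  \<comment> \<open>A leaf has one neighbour in all, so the non-leaves form a saturated set
    containing \<open>D\<close>.\<close>
  have "P \<subseteq> verts G - L"
  proof (rule least)
    show "D \<subseteq> verts G - L"
      using D D_sub by auto
    fix v assume "v \<in> verts G - (verts G - L) - {}"
    then have "card (nbrs v) = 1"
      by (auto simp: in_leaves)
    moreover have "card (nbrs v \<inter> (verts G - L)) \<le> card (nbrs v)"
      by (intro card_mono) auto
    ultimately show "card (nbrs v \<inter> (verts G - L)) \<le> 1"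
      by simp
  qed
  \<comment> \<open>A non-leaf \<open>v\<close> outside \<open>P\<close> would have one neighbour in
    \<open>P\<close> and another one, \<open>u\<close>, outside. Adding \<open>v\<close> costs one,
    and then \<open>u\<close>, adjacent to \<open>v\<close> and to some \<open>q\<close> in
    \<open>P\<close>, costs nothing more: two new vertices for a weight of one violate
    \<open>card_less_weight\<close>.\<close>
  moreover have "v \<in> P" if v: "v \<in> verts G" "v \<notin> L" for v
  proof (rule ccontr)
    assume "v \<notin> P"
    then obtain p where p: "p \<in> P" "v \<sim> p"
      using dom v dominating_setD by blast
    have card_v: "card (nbrs v \<inter> P) = 1"
    proof -
      have "nbrs v \<inter> P \<noteq> {}"
        using p by auto
      then have "0 < card (nbrs v \<inter> P)"
        by (simp add: card_gt_0_iff)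
      then show ?thesis
        using P(3)[of v] v \<open>v \<notin> P\<close> by force
    qed
    have "nbrs v \<noteq> nbrs v \<inter> P"
      using card_v v by (metis in_leaves)
    then obtain u where "u \<in> nbrs v" "u \<notin> P"
      by blast
    then have u: "v \<sim> u" "u \<notin> P"
      by simp_all
    then have "u \<noteq> v" "u \<in> verts G"
      by (auto dest: adj_in_verts)
    obtain q where q: "q \<in> P" "u \<sim> q"
      using dom u \<open>u \<in> verts G\<close> dominating_setD by blast
    have "v \<noteq> q"
      using q \<open>v \<notin> P\<close> by auto
    then have "card {v, q} = 2"
      by simp
    moreover have "card {v, q} \<le> card (nbrs u \<inter> insert v P)"
      using q u adj_sym by (intro card_mono) auto
    ultimately have "weight (insert u (insert v P)) \<le> weight P + 1"
      using weight_insert[of "insert v P" u] weight_insert[of P v] fin u \<open>v \<notin> P\<close> \<open>u \<noteq> v\<close> card_v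
      by simp
    moreover have "int (card (insert u (insert v P))) + 1 \<le> weight (insert u (insert v P))"
      by (rule card_less_weight) (use P v \<open>u \<in> verts G\<close> in auto)
    ultimately show False
      using weight(1) fin u \<open>v \<notin> P\<close> \<open>u \<noteq> v\<close> by simp
  qed
  ultimately have P_eq: "P = verts G - L"
    by auto
  show ?thesis1
    using weight P_eq by simp
  show "?thesis2" if "D \<subseteq> R" "\<And>v. v \<in> verts G - R \<Longrightarrow> card (nbrs v \<inter> R) \<le> 1"
    using least[of R] that P_eq by auto
qed

text \<open>Suppose \<open>d\<close> has at most one leaf, and let \<open>Q\<close> be the saturation of \<open>D - {d}\<close> that avoids \<open>d\<close>.
  Then \<open>Q\<close> contains no neighbour of \<open>d\<close> but dominates all non-leaf neighbours of \<open>d\<close>, so that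
  \<open>Q\<close> together with one further neighbour of \<open>d\<close> is too cheap.\<close>

lemma minimum_dominating_strong:
  assumes D: "dominating_set G D" "card D = domination_number G" "D \<inter> L = {}"
  shows "D \<subseteq> S"
proof
  fix d assume "d \<in> D"
  have D_sub: "D \<subseteq> verts G"
    using D by (simp add: dominating_set_def)
  then have finD: "finite D" and d_vert: "d \<in> verts G"
    using finite_subset_verts \<open>d \<in> D\<close> by auto
  have "D - {d} \<subseteq> verts G"
    using D_sub by auto
  then obtain Q where Q: "D - {d} \<subseteq> Q" "Q \<subseteq> verts G" "(Q - (D - {d})) \<inter> {d} = {}"
    "\<And>v. v \<in> verts G - Q - {d} \<Longrightarrow> card (nbrs v \<inter> Q) \<le> 1" "weight Q \<le> weight (D - {d})"
    by (rule saturation_exists[where Z = "{d}"]) blast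
  then have "d \<notin> Q"
    by auto
  have finQ: "finite Q"
    using Q finite_subset_verts by auto
  \<comment> \<open>\<open>d\<close> has no neighbour in \<open>D\<close>, so dropping it lowers the
    weight by exactly two.\<close>
  have "nbrs d \<inter> (D - {d}) = {}"
    using minimum_dominating_independent[OF D(1,2) \<open>d \<in> D\<close>] by auto
  then have wQ: "weight Q \<le> 2 * int (domination_number G) - 2"
    using weight_remove[OF finD \<open>d \<in> D\<close>] minimum_dominating_weight[OF D(1,2)] Q(5)
    by simp
  have dom_Qd: "dominating_set G (insert d Q)"
    by (rule dominating_set_mono[OF D(1)]) (use Q d_vert in auto)
  \<comment> \<open>Putting \<open>d\<close> back gives a dominating set; an edge from
    \<open>d\<close> to \<open>Q\<close> would leave its weight below the minimum.\<close>
  have "weight (insert d Q) = weight Q + 2 - int (card (nbrs d \<inter> Q))"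
    by (rule weight_insert) (use finQ \<open>d \<notin> Q\<close> in auto)
  then have "card (nbrs d \<inter> Q) = 0"
    using dominating_weight_ge[OF dom_Qd] wQ by linarith
  then have no_nbr: "nbrs d \<inter> Q = {}"
    by simp

  \<comment> \<open>If \<open>y\<close> had no neighbour in \<open>Q\<close>, then \<open>Q\<close>
    together with everything outside the branch \<open>B\<close> at \<open>y\<close> would be
    saturated and contain \<open>D\<close>. It would then contain the non-leaf \<open>y\<close>, so
    that \<open>y\<close> lies in \<open>Q\<close>, against \<open>no_nbr\<close>.\<close>
  have nbr_dom: "nbrs y \<inter> Q \<noteq> {}" if y: "d \<sim> y" "y \<notin> L" for y
  proof
    assume no: "nbrs y \<inter> Q = {}"
    have "y \<in> verts G" "y \<noteq> d"
      using y by (auto dest: adj_in_verts)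
    define B where "B = {v. (\<lambda>a b. a \<sim> b \<and> b \<noteq> d)\<^sup>*\<^sup>* y v}"
    have linked: "linked_from y B"
      unfolding B_def by (rule linked_from_rtranclp) auto
    have B_step: "w \<in> B" if "v \<in> B" "v \<sim> w" "w \<noteq> d" for v w
      using that unfolding B_def by (auto intro: rtranclp.rtrancl_into_rtrancl)
    have "v \<in> verts G \<and> v \<noteq> d" if "v \<in> B" for v
      using that[unfolded B_def mem_Collect_eq]
    proof (induction rule: rtranclp_induct)
      case base
      then show ?case
        using \<open>y \<in> verts G\<close> \<open>y \<noteq> d\<close> by simp
    qed (auto dest: adj_in_verts)
    then have "d \<notin> B" "B \<subseteq> verts G"
      by auto
    have "y \<in> B"
      by (simp add: B_def)
    \<comment> \<open>\<open>B\<close> is connected, so a second edge from \<open>d\<close> into it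
      would close a cycle.\<close>
    have only_y: "v = y" if "v \<in> B" "v \<sim> d" for v
    proof (rule ccontr)
      assume "v \<noteq> y"
      have "{v, y} \<subseteq> nbrs d \<inter> B"
        using that y \<open>y \<in> B\<close> adj_sym by auto
      then have "card {v, y} \<le> card (nbrs d \<inter> B)"
        by (intro card_mono) auto
      moreover have "card (nbrs d \<inter> B) \<le> 1"
        by (rule linked_from_card_nbrs_le) fact+
      ultimately show False
        using \<open>v \<noteq> y\<close> by simp
    qed
    have "verts G - L \<subseteq> Q \<union> (verts G - B)"
    proof (rule minimum_dominating_saturation(2)[OF D])
      show "D \<subseteq> Q \<union> (verts G - B)"
        using Q(1) \<open>d \<notin> B\<close> d_vert by auto
      fix v assume "v \<in> verts G - (Q \<union> (verts G - B))"
      then have v: "v \<in> verts G" "v \<notin> Q" "v \<in> B"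
        by auto
      \<comment> \<open>The only edge leaving \<open>B\<close> joins \<open>y\<close> to
        \<open>d\<close>, so any other vertex of \<open>B\<close> has only its neighbours in
        \<open>Q\<close> to count.\<close>
      show "card (nbrs v \<inter> (Q \<union> (verts G - B))) \<le> 1"
      proof (cases "v = y")
        case True
        then have "nbrs v \<inter> (Q \<union> (verts G - B)) \<subseteq> {d}"
          using no B_step \<open>y \<in> B\<close> by auto
        then show ?thesis
          using card_mono[of "{d}"] by force
      next
        case False
        then have "w \<in> B" if "v \<sim> w" for w
          using B_step only_y v that by blast
        then have "nbrs v \<inter> (Q \<union> (verts G - B)) \<subseteq> nbrs v \<inter> Q"
          by auto
        then have "card (nbrs v \<inter> (Q \<union> (verts G - B))) \<le> card (nbrs v \<inter> Q)"
          by (intro card_mono) auto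
        also have "\<dots> \<le> 1"
          using Q(4) v \<open>d \<notin> B\<close> by auto
        finally show ?thesis .
      qed
    qed
    then have "y \<in> Q"
      using \<open>y \<in> B\<close> \<open>y \<in> verts G\<close> y by auto
    then show False
      using no_nbr y by auto
  qed

  \<comment> \<open>Here \<open>x\<close> replaces \<open>d\<close>: it dominates \<open>d\<close>
    and is the only possible leaf at \<open>d\<close>. \<open>Q\<close> dominates the non-leaf
    neighbours of \<open>d\<close>, and \<open>D - {d}\<close> dominates the rest.\<close>
  have dom_Qx: "dominating_set G (insert x Q)" if x: "d \<sim> x" "nbrs d \<inter> L \<subseteq> {x}" for x
    unfolding dominating_set_def
  proof (intro conjI ballI)
    show "insert x Q \<subseteq> verts G"
      using x Q by (auto dest: adj_in_verts)
    fix v assume v: "v \<in> verts G - insert x Q"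
    show "\<exists>u\<in>insert x Q. v \<sim> u"
    proof (cases "v = d \<or> (d \<sim> v \<and> v \<notin> L)")
      case True
      then have "v = d \<or> nbrs v \<inter> Q \<noteq> {}"
        using nbr_dom[of v] by blast
      then show ?thesis
        using x by auto
    next
      case False
      then have "v \<notin> nbrs d"
        using v x by auto
      obtain u where u: "u \<in> D" "v \<sim> u"
        using D v False Q dominating_setD[of D v] by blast
      then have "u \<noteq> d"
        using \<open>v \<notin> nbrs d\<close> adj_sym by auto
      then show ?thesis
        using u Q by auto
    qed
  qed

  show "d \<in> S"
  proof (rule ccontr)
    assume "d \<notin> S"
    then have small: "card (nbrs d \<inter> L) \<le> 1"
      using d_vert by (simp add: in_strong_support_vertices)
    show False
    proof (cases "nbrs d \<inter> L = {}")
      case True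
      \<comment> \<open>Without a leaf at \<open>d\<close>, any neighbour \<open>y\<close> of
        \<open>d\<close> has a neighbour in \<open>Q\<close>, so adding it to \<open>Q\<close> costs
        at most one and gives a dominating set that is too light.\<close>
      have "nbrs d \<noteq> {}"
      proof
        assume "nbrs d = {}"
        have "card {d} \<noteq> card (verts G)"
          using large by simp
        then have "{d} \<subset> verts G"
          using d_vert by (metis empty_subsetI insert_subset psubsetI)
        then show False
          using linked_fromD[OF linked_from_verts[OF d_vert], of "{d}"] \<open>nbrs d = {}\<close> in_nbrs
          by (metis empty_iff singletonD singletonI)
      qed
      then obtain y where y: "d \<sim> y"
        by auto
      then have "y \<notin> L" "y \<notin> Q"
        using True no_nbr by auto
      then have "1 \<le> card (nbrs y \<inter> Q)"
        using nbr_dom[OF y] by (simp add: Suc_le_eq card_gt_0_iff)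
      then have "weight (insert y Q) \<le> weight Q + 1"
        using weight_insert[of Q y] finQ \<open>y \<notin> Q\<close> by simp
      then show False
        using dominating_weight_ge[OF dom_Qx[of y]] y True wQ by simp
    next
      case False
      \<comment> \<open>With one leaf \<open>l\<close>, adding it to \<open>Q\<close> costs two, so
        the weight of a dominating set gives no contradiction. But \<open>insert l Q\<close> is
        already perfect dominating and has at most \<open>weight Q\<close> elements, which is too
        few.\<close>
      then obtain l where l: "l \<in> L" "d \<sim> l"
        by auto
      have sub: "nbrs d \<inter> L \<subseteq> {l}"
      proof
        fix x assume "x \<in> nbrs d \<inter> L"
        then have "card {x, l} \<le> card (nbrs d \<inter> L)"
          using l by (intro card_mono) auto
        then show "x \<in> {l}"
          using small by (cases "x = l") auto
      qed
      have "l \<sim> d"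
        using l adj_sym by auto
      \<comment> \<open>The bound on \<open>card Q\<close> requires a vertex; with \<open>Q\<close>
        empty, \<open>l\<close> would be the only neighbour of \<open>d\<close>, making
        \<open>d\<close> a leaf.\<close>
      have "Q \<noteq> {}"
      proof
        assume "Q = {}"
        then have "nbrs d \<subseteq> {l}"
          using nbr_dom sub by fastforce
        then have "nbrs d = {l}"
          using l by auto
        then have "d \<in> L"
          using d_vert by (simp add: in_leaves)
        then show False
          using D(3) \<open>d \<in> D\<close> by auto
      qed
      then have "int (card Q) + 1 \<le> weight Q"
        using card_less_weight Q(2) by auto
      moreover have "card (insert l Q) \<le> card Q + 1"
        using finQ by (simp add: card_insert_if)
      moreover have "perfect_dominating_set G (insert l Q)"
      proof (rule perfect_dominating_setI)
        show "dominating_set G (insert l Q)"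
          using dom_Qx l sub by auto
        fix v assume v: "v \<in> verts G - insert l Q"
        show "card (nbrs v \<inter> insert l Q) \<le> 1"
        proof (cases "v = d")
          case True
          then have "nbrs v \<inter> insert l Q \<subseteq> {l}"
            using no_nbr by auto
          then show ?thesis
            using card_mono[of "{l}"] by force
        next
          case False
          then have "\<not> v \<sim> l"
            using leaf_nbr_unique[OF l(1) \<open>l \<sim> d\<close>] adj_sym by auto
          then have "nbrs v \<inter> insert l Q = nbrs v \<inter> Q"
            by auto
          then show ?thesis
            using Q(4) v False by auto
        qed
      qed
      ultimately show False
        using perfect_domination_number_le[of "insert l Q"] extremal domination_number_pos wQ
        by linarith
    qed
  qed
qed

end
section \<open>The components outside the strong support vertices and the leaves\<close>

context graph
begin

lemma wf_digraph_induced: "wf_digraph (G \<restriction> (verts G - X))"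
  by (rule wellformed_induce_subgraph)

lemma components_outside_subgraph:
  assumes "C \<in> components_outside G X"
  shows "subgraph C G"
proof -
  have "subgraph C (G \<restriction> (verts G - X))"
    using assms by (auto simp: components_outside_def pre_digraph.sccs_def)
  moreover have "subgraph (G \<restriction> (verts G - X)) G"
    by (rule induced_imp_subgraph) (rule induced_induce, auto)
  ultimately show ?thesis
    by (rule subgraph_trans)
qed

lemma components_outside_verts_subset:
  assumes "C \<in> components_outside G X"
  shows "verts C \<subseteq> verts G - X"
proof -
  have "subgraph C (G \<restriction> (verts G - X))"
    using assms by (auto simp: components_outside_def pre_digraph.sccs_def)
  then show ?thesis
    by (simp add: subgraph_def)
qed

lemma components_outside_linked:
  assumes "C \<in> components_outside G X" "r \<in> verts C"
  shows "linked_from r (verts C)"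
  using assms components_outside_subgraph
  by (intro linked_from_strongly_connected)
    (auto simp: components_outside_def pre_digraph.sccs_def)

lemma components_outside_nonempty:
  "C \<in> components_outside G X \<Longrightarrow> verts C \<noteq> {}"
  by (auto simp: components_outside_def pre_digraph.sccs_def strongly_connected_def)

lemma adj_induced:
  assumes "u \<sim> v" "u \<in> W" "v \<in> W"
  shows "u \<rightarrow>\<^bsub>G \<restriction> W\<^esub> v"
  using assms by (auto simp: arcs_ends_conv)

lemma components_outside_verts:
  "verts ` components_outside G X = pre_digraph.sccs_verts (G \<restriction> (verts G - X))"
  using wf_digraph.sccs_verts_conv[OF wf_digraph_induced] by (simp add: components_outside_def)

text \<open>Arcs are symmetric, so adjacent vertices outside \<open>X\<close> reach each other and
  lie in the same strongly connected component.\<close>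

lemma components_outside_closed:
  assumes "C \<in> components_outside G X" "u \<in> verts C" "v \<in> verts G - X" "u \<sim> v"
  shows "v \<in> verts C"
proof (rule ccontr)
  assume "v \<notin> verts C"
  let ?H = "G \<restriction> (verts G - X)"
  interpret H: wf_digraph ?H
    by (rule wf_digraph_induced)
  have "u \<in> verts G - X"
    using assms components_outside_verts_subset by blast
  then have "u \<rightarrow>\<^bsub>?H\<^esub> v" "v \<rightarrow>\<^bsub>?H\<^esub> u"
    using assms adj_sym by (auto intro: adj_induced)
  then have "u \<rightarrow>\<^sup>*\<^bsub>?H\<^esub> v" "v \<rightarrow>\<^sup>*\<^bsub>?H\<^esub> u"
    by auto
  moreover have "verts C \<in> H.sccs_verts"
    using assms(1) components_outside_verts by auto
  ultimately show False
    using assms(2) \<open>v \<notin> verts C\<close> unfolding H.sccs_verts_def by blast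
qed

lemma components_outside_disjoint:
  assumes "A \<in> verts ` components_outside G X" "B \<in> verts ` components_outside G X" "A \<noteq> B"
  shows "A \<inter> B = {}"
  using assms wf_digraph.sccs_verts_disjoint[OF wf_digraph_induced]
  unfolding components_outside_verts by blast

lemma components_outside_cover:
  "\<Union> (verts ` components_outside G X) = verts G - X"
proof
  show "\<Union> (verts ` components_outside G X) \<subseteq> verts G - X"
    using components_outside_verts_subset by blast
  show "verts G - X \<subseteq> \<Union> (verts ` components_outside G X)"
  proof
    fix v assume v: "v \<in> verts G - X"
    interpret H: wf_digraph "G \<restriction> (verts G - X)"
      by (rule wf_digraph_induced)
    have "v \<in> verts (G \<restriction> (verts G - X))"
      using v by simp
    then show "v \<in> \<Union> (verts ` components_outside G X)"
      unfolding components_outside_verts using H.in_scc_of_self H.scc_of_in_sccs_verts by blast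
  qed
qed

end

text \<open>After one is subtracted from every term the sum must be one, so exactly one term has an
  excess, and that excess is one.\<close>

lemma sum_eq_Suc_card_iff:
  fixes g :: "'a \<Rightarrow> nat"
  assumes "finite C" "\<And>v. v \<in> C \<Longrightarrow> 1 \<le> g v"
  shows "(\<Sum>v\<in>C. g v) = card C + 1 \<longleftrightarrow> (\<exists>w\<in>C. g w = 2 \<and> (\<forall>v\<in>C - {w}. g v = 1))"
proof -
  have "(\<Sum>v\<in>C. g v) = (\<Sum>v\<in>C. (g v - 1) + 1)"
    using assms(2) by (intro sum.cong refl le_add_diff_inverse2[symmetric])
  then have "(\<Sum>v\<in>C. g v) = (\<Sum>v\<in>C. g v - 1) + card C"
    by (simp only: sum.distrib) simp
  then have "(\<Sum>v\<in>C. g v) = card C + 1 \<longleftrightarrow> (\<Sum>v\<in>C. g v - 1) = 1"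
    by simp
  also have "\<dots> \<longleftrightarrow> (\<exists>w\<in>C. g w - 1 = 1 \<and> (\<forall>v\<in>C. w \<noteq> v \<longrightarrow> g v - 1 = 0))"
    by (rule sum_eq_1_iff[OF assms(1)])
  also have "\<dots> \<longleftrightarrow> (\<exists>w\<in>C. g w = 2 \<and> (\<forall>v\<in>C - {w}. g v = 1))"
  proof (rule bex_cong[OF refl])
    fix w assume "w \<in> C"
    have "g v - 1 = 0 \<longleftrightarrow> g v = 1" if "v \<in> C" for v
      using assms(2)[OF that] by linarith
    then show "(g w - 1 = 1 \<and> (\<forall>v\<in>C. w \<noteq> v \<longrightarrow> g v - 1 = 0)) \<longleftrightarrow>
        (g w = 2 \<and> (\<forall>v\<in>C - {w}. g v = 1))"
      using assms(2)[OF \<open>w \<in> C\<close>] by auto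
  qed
  finally show ?thesis .
qed

section \<open>Edges between a component and the strong support vertices\<close>

context large_tree
begin

lemma finite_component: "C \<in> components_outside G X \<Longrightarrow> finite (verts C)"
  using components_outside_verts_subset finite_subset_verts by blast

text \<open>Two neighbours of one \<open>s\<close> in the connected \<open>C\<close> would close a
  cycle, so an edge between \<open>S\<close> and \<open>C\<close> is determined by its end in
  \<open>S\<close>.\<close>

lemma card_component_nbrs:
  assumes "C \<in> components_outside G (S \<union> L)"
  shows "card (neighbors G (verts C) \<inter> S) = card (crossing S (verts C))"
proof -
  have sub: "verts C \<subseteq> verts G - (S \<union> L)"
    by (rule components_outside_verts_subset[OF assms])
  obtain r where "r \<in> verts C"
    using components_outside_nonempty[OF assms] by auto
  have one: "c = d" if "s \<in> S" "c \<in> verts C" "d \<in> verts C" "s \<sim> c" "s \<sim> d" for s c d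
  proof (rule ccontr)
    assume "c \<noteq> d"
    have "card {c, d} \<le> card (nbrs s \<inter> verts C)"
      using that by (intro card_mono) auto
    moreover have "card (nbrs s \<inter> verts C) \<le> 1"
      by (rule linked_from_card_nbrs_le[OF components_outside_linked[OF assms \<open>r \<in> verts C\<close>]])
        (use that sub strong_subset in auto)
    ultimately show False
      using \<open>c \<noteq> d\<close> by simp
  qed
  have "inj_on fst (crossing S (verts C))"
    by (rule inj_onI) (auto simp: crossing_def intro: one)
  moreover have "fst ` crossing S (verts C) = neighbors G (verts C) \<inter> S"
  proof (intro equalityI subsetI)
    fix s assume "s \<in> fst ` crossing S (verts C)"
    then obtain c where "s \<in> S" "c \<in> verts C" "s \<sim> c"
      by (auto simp: crossing_def)
    then show "s \<in> neighbors G (verts C) \<inter> S"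
      using adj_sym[of s c] strong_subset by (auto simp: neighbors_def)
  next
    fix s assume "s \<in> neighbors G (verts C) \<inter> S"
    then obtain c where "s \<in> S" "c \<in> verts C" "c \<sim> s"
      by (auto simp: neighbors_def)
    then have "(s, c) \<in> crossing S (verts C)"
      using adj_sym by (auto simp: crossing_def)
    then show "s \<in> fst ` crossing S (verts C)"
      by force
  qed
  ultimately show ?thesis
    by (metis card_image)
qed

text \<open>Both sides count the edges between \<open>S\<close> and \<open>C\<close>, the second one
  from the side of \<open>C\<close>, where domination makes every vertex contribute at least
  one.\<close>

lemma component_condition_iff:
  assumes "dominating_set G S" "C \<in> components_outside G (S \<union> L)"
  shows "card (neighbors G (verts C) \<inter> S) = card (verts C) + 1 \<longleftrightarrow>
    (\<exists>w \<in> verts C. card (nbrs w \<inter> S) = 2 \<and> (\<forall>v \<in> verts C - {w}. card (nbrs v \<inter> S) = 1))"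
proof -
  have "1 \<le> card (nbrs v \<inter> S)" if v: "v \<in> verts C" for v
  proof -
    have "v \<in> verts G" "v \<notin> S"
      using v components_outside_verts_subset[OF assms(2)] by auto
    then obtain u where "u \<in> S" "v \<sim> u"
      using dominating_setD[OF assms(1)] by blast
    then have "nbrs v \<inter> S \<noteq> {}"
      by auto
    then show ?thesis
      by (simp add: Suc_le_eq card_gt_0_iff)
  qed
  then have "(\<Sum>v\<in>verts C. card (nbrs v \<inter> S)) = card (verts C) + 1 \<longleftrightarrow>
      (\<exists>w \<in> verts C. card (nbrs w \<inter> S) = 2 \<and> (\<forall>v \<in> verts C - {w}. card (nbrs v \<inter> S) = 1))"
    by (rule sum_eq_Suc_card_iff[OF finite_component[OF assms(2)]])
  then show ?thesis
    unfolding card_component_nbrs[OF assms(2)]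
      card_crossing_right[OF finite_subset_verts[OF strong_subset] finite_component[OF assms(2)]] .
qed

text \<open>A non-leaf outside \<open>S\<close> that is adjacent to \<open>C\<close> belongs to
  \<open>C\<close>.\<close>

lemma crossing_component:
  assumes "C \<in> components_outside G (S \<union> L)" "S \<subseteq> Y" "Y \<subseteq> verts G - L - verts C"
  shows "crossing Y (verts C) = crossing S (verts C)"
proof
  show "crossing S (verts C) \<subseteq> crossing Y (verts C)"
    using assms(2) by (auto simp: crossing_def)
  show "crossing Y (verts C) \<subseteq> crossing S (verts C)"
  proof
    fix p assume "p \<in> crossing Y (verts C)"
    then obtain a c where p: "p = (a, c)" "a \<in> Y" "c \<in> verts C" "a \<sim> c"
      by (auto simp: crossing_def)
    have "a \<in> S"
    proof (rule ccontr)
      assume "a \<notin> S"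
      then have "a \<in> verts C"
        using components_outside_closed[OF assms(1) p(3)] p(2) assms(3) adj_sym[OF p(4)] by auto
      then show False
        using p assms(3) by auto
    qed
    then show "p \<in> crossing S (verts C)"
      using p by (auto simp: crossing_def)
  qed
qed

text \<open>A connected \<open>C\<close> has weight \<open>card (verts C) + 1\<close>, and its edges
  to \<open>Y\<close> are those to \<open>S\<close>, one for each neighbour there. The weight stays
  unchanged exactly under the component condition.\<close>

lemma weight_add_component:
  assumes C: "C \<in> components_outside G (S \<union> L)" and Y: "S \<subseteq> Y" "Y \<subseteq> verts G - L - verts C"
  shows "weight (Y \<union> verts C) =
    weight Y + int (card (verts C)) + 1 - int (card (neighbors G (verts C) \<inter> S))"
proof -
  obtain r where "r \<in> verts C"
    using components_outside_nonempty[OF C] by auto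
  have "finite Y"
    by (rule finite_subset_verts) (use Y in blast)
  then have "weight (Y \<union> verts C) = weight Y + weight (verts C) - int (card (crossing Y (verts C)))"
    using finite_component[OF C] Y by (intro weight_Un) auto
  moreover have "card (verts C) = card (edges_within (verts C)) + 1"
    by (rule linked_from_card_eq[OF components_outside_linked[OF C \<open>r \<in> verts C\<close>]])
      (use components_outside_verts_subset[OF C] in auto)
  ultimately show ?thesis
    unfolding crossing_component[OF assms] card_component_nbrs[OF C] by (simp add: weight_def)
qed

lemma nonleaves_eq: "verts G - L = S \<union> \<Union> (verts ` components_outside G (S \<union> L))"
  unfolding components_outside_cover using strong_subset strong_not_leaf by auto

section \<open>Sufficiency of the conditions\<close>

lemma extremal_if_conditions:
  assumes ind: "independent_set G S" and dom: "dominating_set G S"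
    and comp: "\<And>C. C \<in> components_outside G (S \<union> L) \<Longrightarrow>
      card (neighbors G (verts C) \<inter> S) = card (verts C) + 1"
  shows "perfect_domination_number G = 2 * domination_number G - 1"
proof -
  have card_S: "card S = domination_number G"
    using card_strong_le_domination_number domination_number_le[OF dom] by simp
  have "edges_within S = {}"
    using ind by (auto simp: edges_within_def independent_set_def)
  then have weight_S: "weight S = 2 * int (domination_number G)"
    by (simp add: weight_def card_S)
  let ?\<C> = "verts ` components_outside G (S \<union> L)"
  have "finite ?\<C>"
    by (rule finite_subset[of _ "Pow (verts G)"]) (use components_outside_verts_subset in auto)
  \<comment> \<open>Components join \<open>S\<close> one at a time without changing the weight,
    until all non-leaves are reached.\<close>
  have "weight (S \<union> \<Union> K) = weight S" if K: "K \<subseteq> ?\<C>" for K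
    using finite_subset[OF K \<open>finite ?\<C>\<close>] K
  proof (induction K rule: finite_induct)
    case (insert A K)
    then obtain C where C: "C \<in> components_outside G (S \<union> L)" "A = verts C"
      by auto
    have "B \<inter> A = {} \<and> B \<subseteq> verts G - L" if B: "B \<in> K" for B
    proof -
      have "B \<in> ?\<C>" "B \<noteq> A" "A \<in> ?\<C>"
        using B insert by auto
      then show ?thesis
        using components_outside_disjoint components_outside_verts_subset by blast
    qed
    moreover have "S \<inter> A = {}"
      using components_outside_verts_subset[OF C(1)] C(2) by auto
    ultimately have "S \<union> \<Union> K \<subseteq> verts G - L - verts C"
      using strong_subset strong_not_leaf C(2) by blast
    then have "weight (S \<union> \<Union> K \<union> verts C) = weight (S \<union> \<Union> K)"
      using weight_add_component[OF C(1), of "S \<union> \<Union> K"] comp[OF C(1)] by simp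
    moreover have "S \<union> \<Union> (insert A K) = S \<union> \<Union> K \<union> verts C"
      using C(2) by auto
    ultimately show ?case
      using insert by simp
  qed simp
  from this[of ?\<C>] have "weight (verts G - L) = 2 * int (domination_number G)"
    using weight_S nonleaves_eq by simp
  then have lower: "2 * domination_number G \<le> card (verts G - L) + 1"
    using weight_nonleaves by simp

  obtain P where P: "perfect_dominating_set G P" "card P = perfect_domination_number G"
    by (rule perfect_domination_number_attained)
  have "S \<subseteq> P"
    by (rule strong_subset_perfect_dominating[OF P(1)])
  \<comment> \<open>The vertex \<open>w\<close> with two neighbours in \<open>S\<close> is forced
    into \<open>P\<close>. From there membership spreads along the edges of \<open>C\<close>: the
    next vertex \<open>v\<close> has a neighbour \<open>u\<close> in \<open>P\<close> inside
    \<open>C\<close> and a neighbour \<open>s\<close> in \<open>S\<close>.\<close>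
  have comp_sub: "verts C \<subseteq> P" if C: "C \<in> components_outside G (S \<union> L)" for C
  proof (rule ccontr)
    assume no: "\<not> verts C \<subseteq> P"
    have sub: "verts C \<subseteq> verts G - (S \<union> L)"
      by (rule components_outside_verts_subset[OF C])
    obtain w where w: "w \<in> verts C" "card (nbrs w \<inter> S) = 2"
      using component_condition_iff[OF dom C] comp[OF C] by blast
    then obtain a b where "nbrs w \<inter> S = {a, b}" "a \<noteq> b"
      by (meson card_2_iff)
    then have ab: "a \<in> nbrs w \<inter> S" "b \<in> nbrs w \<inter> S" "a \<noteq> b"
      by auto
    have "w \<in> P"
      by (rule perfect_dominating_set_forced[OF P(1), of w a b]) (use ab w \<open>S \<subseteq> P\<close> sub in auto)
    then obtain u v where u: "u \<in> verts C \<inter> P" and v: "v \<in> verts C - verts C \<inter> P" and "u \<sim> v"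
      using linked_fromD[OF components_outside_linked[OF C w(1)], of "verts C \<inter> P"] w(1) no
      by blast
    then have "v \<in> verts G" "v \<notin> S" "v \<sim> u" "u \<notin> S"
      using sub adj_sym by auto
    then obtain s where "s \<in> S" "v \<sim> s"
      using dominating_setD[OF dom] by blast
    then have "v \<in> P"
      using perfect_dominating_set_forced[OF P(1), of v u s] \<open>v \<in> verts G\<close> \<open>v \<sim> u\<close> \<open>u \<notin> S\<close>
        u \<open>S \<subseteq> P\<close> by blast
    then show False
      using v by auto
  qed
  have "verts G - L \<subseteq> P"
    unfolding nonleaves_eq using \<open>S \<subseteq> P\<close> comp_sub by blast
  moreover have "finite P"
    using P(1) finite_subset_verts by (auto simp: perfect_dominating_set_def)
  ultimately have "card (verts G - L) \<le> perfect_domination_number G"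
    using P(2) card_mono by metis
  then show ?thesis
    using lower perfect_domination_number_le_double by linarith
qed

end

section \<open>Necessity of the conditions\<close>

context extremal_tree
begin

text \<open>A leafless minimum dominating set lies in \<open>S\<close> by
  \<open>minimum_dominating_strong\<close> and contains \<open>S\<close> because it dominates the
  leaves.\<close>

lemma strong_minimum_dominating:
  "dominating_set G S" "card S = domination_number G"
proof -
  obtain D where D: "dominating_set G D" "card D = domination_number G" "D \<inter> L = {}"
    by (rule leafless_minimum_dominating_set)
  then have "D = S"
    using minimum_dominating_strong strong_subset_dominating by blast
  with D show "dominating_set G S" "card S = domination_number G"
    by auto
qed

lemma strong_independent: "independent_set G S"
  using minimum_dominating_independent[OF strong_minimum_dominating] strong_subset
  by (simp add: independent_set_def)

text \<open>Both \<open>S \<union> C\<close> and the non-leaves outside \<open>C\<close> dominate; comparing their weights with that of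
  \<open>S\<close> and of all non-leaves gives the two inequalities.\<close>

lemma component_condition:
  assumes C: "C \<in> components_outside G (S \<union> L)"
  shows "card (neighbors G (verts C) \<inter> S) = card (verts C) + 1"
proof -
  note S = strong_minimum_dominating
  have sub: "verts C \<subseteq> verts G - (S \<union> L)"
    by (rule components_outside_verts_subset[OF C])
  have "dominating_set G (S \<union> verts C)"
    by (rule dominating_set_mono[OF S(1)]) (use sub strong_subset in auto)
  then have "2 * int (domination_number G) \<le> weight (S \<union> verts C)"
    by (rule dominating_weight_ge)
  moreover have "weight (S \<union> verts C) =
      weight S + int (card (verts C)) + 1 - int (card (neighbors G (verts C) \<inter> S))"
    by (rule weight_add_component[OF C]) (use sub strong_subset strong_not_leaf in auto)
  ultimately have upper: "card (neighbors G (verts C) \<inter> S) \<le> card (verts C) + 1"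
    using minimum_dominating_weight[OF S] by simp
  let ?Y = "verts G - L - verts C"
  have "S \<subseteq> ?Y"
    using sub strong_subset strong_not_leaf by auto
  then have "dominating_set G ?Y"
    by (intro dominating_set_mono[OF S(1)]) auto
  then have "2 * int (domination_number G) \<le> weight ?Y"
    by (rule dominating_weight_ge)
  moreover have "weight (?Y \<union> verts C) =
      weight ?Y + int (card (verts C)) + 1 - int (card (neighbors G (verts C) \<inter> S))"
    by (rule weight_add_component[OF C \<open>S \<subseteq> ?Y\<close>]) simp
  moreover have "?Y \<union> verts C = verts G - L"
    using sub by auto
  moreover have "weight (verts G - L) = 2 * int (domination_number G)"
    by (rule minimum_dominating_saturation(1)[OF S]) (rule strong_not_leaf)
  ultimately show ?thesis
    using upper by simp
qed

end

lemma undirected_tree_imp_tree_graph: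
  assumes "undirected_tree T"
  shows "tree_graph T"
  using assms unfolding undirected_tree_def tree_graph_def tree_graph_axioms_def
  by (meson not_le_imp_less)

text \<open>Trees with one or two vertices are excluded: there both numbers are 1 although no strong
  support vertex exists. The second conjunct justifies, under the first condition, reading the
  component condition vertex by vertex.\<close>

theorem theorem3:
  fixes T :: "('a, 'b) pre_digraph" and L S :: "'a set"
  assumes "undirected_tree T"
    and "3 \<le> card (verts T)"
  defines "L \<equiv> leaves T"
    and "S \<equiv> strong_support_vertices T"
  shows "(perfect_domination_number T = 2 * domination_number T - 1 \<longleftrightarrow>
            (independent_set T S \<and> dominating_set T S) \<and>
            (\<forall>C \<in> components_outside T (S \<union> L).
               card (neighbors T (verts C) \<inter> S) = card (verts C) + 1)) \<and>
         (independent_set T S \<and> dominating_set T S \<longrightarrow>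
            (\<forall>C \<in> components_outside T (S \<union> L).
               card (neighbors T (verts C) \<inter> S) = card (verts C) + 1 \<longleftrightarrow>
               (\<exists>w \<in> verts C. card (neighbors T {w} \<inter> S) = 2 \<and>
                  (\<forall>v \<in> verts C - {w}. card (neighbors T {v} \<inter> S) = 1))))"
proof -
  interpret large_tree T
    using undirected_tree_imp_tree_graph[OF assms(1)] assms(2)
    by (intro large_tree.intro large_tree_axioms.intro)
  have "independent_set T S \<and> dominating_set T S \<and>
      (\<forall>C \<in> components_outside T (S \<union> L).
        card (neighbors T (verts C) \<inter> S) = card (verts C) + 1)"
    if ext: "perfect_domination_number T = 2 * domination_number T - 1"
  proof -
    interpret extremal_tree T
      by unfold_locales (rule ext)
    show ?thesis
      unfolding L_def S_def
      using strong_independent strong_minimum_dominating(1) component_condition by blast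
  qed
  then show ?thesis
    using extremal_if_conditions component_condition_iff unfolding L_def S_def by blast
qed

end
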